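(* Let $\alpha\in\overline{\mathsf{KM}}_n^{\ge1}$ and let $\beta\in\mathsf{Qlswap}(\alpha)$. Then the quasi-key polynomial $\mathfrak{D}_\beta$ is multiplicity-free, i.e. every coefficient in its expansion into monomials is $0$ or $1$.
   Context: A weak composition of length $n$ is $\alpha=(\alpha_1,\ldots,\alpha_n)\in\mathbb{Z}_{\ge0}^n$; the set of these is $\mathsf{Comp}_n$. For weak compositions $\alpha=(\alpha_1,\ldots,\alpha_\ell)$, $\beta=(\beta_1,\ldots,\beta_k)$, $\alpha$ contains the composition pattern $\beta$ if there exist $1\le j_1<\cdots<j_k\le\ell$ such that for all $s,t$: $\alpha_{j_s}\le\alpha_{j_t}$ if and only if $\beta_s\le\beta_t$, and $|\alpha_{j_s}-\alpha_{j_t}|\ge|\beta_s-\beta_t|$. Otherwise $\alpha$ avoids $\beta$. $\overline{\mathsf{KM}}_n^{\ge1}$ is the set of $\alpha\in\mathsf{Comp}_n$ with $\alpha_i\ge1$ for all $1\le i\le n$ that avoid all of $(0,1,2),(0,0,2,2),(0,0,2,1),(1,0,3,2),(1,0,2,2)$. Skyline diagram: $D(\alpha)=\{(i,j):1\le i\le n,\ 1\le j\le\alpha_i\}$, where $i$ indexes rows from south (bottom) to north (top) and $j$ indexes columns from left to right. A quasi-key tableau $T$ of shape $\alpha$ is a filling of the boxes of $D(\alpha)$ with positive integers $T(i,j)$ such that: (QK1) entries weakly decrease left to right along rows, and entries in row $i$ are at most $i$; (QK2) entries in each column are distinct, and entries increase upward in the first column; (QK3) if $i$ appears above $k$ in the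 same column and $i<k$, then there is a $j$ that appears immediately to the right of that $k$, and $i<j$; (QK4) if $r<s$, $\alpha_r<\alpha_s$, and $(r,c),(s,c+1)\in D(\alpha)$, then $T(r,c)<T(s,c+1)$. $\mathsf{qKT}(\alpha)$ is the set of quasi-key tableaux of shape $\alpha$. The weight $\mathsf{wt}(T)=(w_1,w_2,\ldots)$ has $w_i$ equal to the number of $i$'s in $T$. The quasi-key polynomial is $\mathfrak{D}_\alpha=\sum_{T\in\mathsf{qKT}(\alpha)}x^{\mathsf{wt}(T)}$. A left swap of $\alpha\in\mathsf{Comp}_n$ is the composition $(\alpha_1,\ldots,\alpha_j,\ldots,\alpha_i,\ldots,\alpha_n)$ obtained by exchanging the entries in positions $i<j$ where $\alpha_i<\alpha_j$. $\mathsf{lswap}(\alpha)$ is the set of all compositions obtained by iteratively applying a (possibly empty) sequence of left swaps to $\alpha$. $\mathsf{flat}(\alpha)$ is $\alpha$ with all $0$'s removed. Dominance order on $\mathsf{Comp}_n$: $\alpha\ge_{\mathsf{Dom}}\beta$ if $\sum_{i=1}^t\alpha_i\ge\sum_{i=1}^t\beta_i$ for all $1\le t\le n$. Finally, $$\mathsf{Qlswap}(\alpha)=\{\gamma\in\mathsf{lswap}(\alpha):\gamma\le_{\mathsf{Dom}}\tau\text{ for all }\tau\in\mathsf{lswap}(\alpha)\text{ such that }\mathsf{flat}(\gamma)=\mathsf{flat}(\tau)\}.$$ *)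

theory Defs
  imports "HOL-Library.Poly_Mapping" "HOL-Library.FuncSet"
begin

text \<open>
  A weak composition of length \<open>n\<close> is a list of \<open>n\<close> natural numbers. The part that is written
  \<open>\<alpha>\<^sub>i\<close> with \<open>i\<close> starting at \<open>1\<close> is the list entry \<open>\<alpha> ! (i - 1)\<close>. Positions in compositions and
  patterns are list positions, starting at \<open>0\<close>; the rows and columns of diagrams start at \<open>1\<close>,
  since the condition ``entries in row \<open>i\<close> are at most \<open>i\<close>'' refers to the row number.
\<close>

type_synonym comp = "nat list"

definition Comp :: "nat \<Rightarrow> comp set" where
  "Comp n = {\<alpha>. length \<alpha> = n}"

definition contains_pattern :: "comp \<Rightarrow> comp \<Rightarrow> bool" where
  "contains_pattern \<alpha> \<beta> \<longleftrightarrow>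
     (\<exists>j. strict_mono_on {..<length \<beta>} j \<and> j ` {..<length \<beta>} \<subseteq> {..<length \<alpha>} \<and>
        (\<forall>s<length \<beta>. \<forall>t<length \<beta>.
           (\<alpha> ! j s \<le> \<alpha> ! j t \<longleftrightarrow> \<beta> ! s \<le> \<beta> ! t) \<and>
           \<bar>int (\<alpha> ! j s) - int (\<alpha> ! j t)\<bar> \<ge> \<bar>int (\<beta> ! s) - int (\<beta> ! t)\<bar>))"

abbreviation avoids_pattern :: "comp \<Rightarrow> comp \<Rightarrow> bool" where
  "avoids_pattern \<alpha> \<beta> \<equiv> \<not> contains_pattern \<alpha> \<beta>"

definition KM_bar_ge1 :: "nat \<Rightarrow> comp set" where
  "KM_bar_ge1 n =
     {\<alpha> \<in> Comp n. (\<forall>i<n. \<alpha> ! i \<ge> 1) \<and>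
        (\<forall>\<beta> \<in> {[0,1,2], [0,0,2,2], [0,0,2,1], [1,0,3,2], [1,0,2,2]}. avoids_pattern \<alpha> \<beta>)}"

definition skyline :: "comp \<Rightarrow> (nat \<times> nat) set" where
  "skyline \<alpha> = {(i, j). 1 \<le> i \<and> i \<le> length \<alpha> \<and> 1 \<le> j \<and> j \<le> \<alpha> ! (i - 1)}"

lemma finite_skyline: "finite (skyline \<alpha>)"
proof (rule finite_subset)
  show "skyline \<alpha> \<subseteq> (SIGMA i:{1..length \<alpha>}. {1..\<alpha> ! (i - 1)})"
    by (auto simp: skyline_def)
qed auto

type_synonym filling = "nat \<times> nat \<Rightarrow> nat"

definition QK1 :: "comp \<Rightarrow> filling \<Rightarrow> bool" where
  "QK1 \<alpha> T \<longleftrightarrow>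
     (\<forall>i j. (i, j) \<in> skyline \<alpha> \<and> (i, j + 1) \<in> skyline \<alpha> \<longrightarrow> T (i, j) \<ge> T (i, j + 1)) \<and>
     (\<forall>i j. (i, j) \<in> skyline \<alpha> \<longrightarrow> T (i, j) \<le> i)"

definition QK2 :: "comp \<Rightarrow> filling \<Rightarrow> bool" where
  "QK2 \<alpha> T \<longleftrightarrow>
     (\<forall>r s c. (r, c) \<in> skyline \<alpha> \<and> (s, c) \<in> skyline \<alpha> \<and> r \<noteq> s \<longrightarrow> T (r, c) \<noteq> T (s, c)) \<and>
     (\<forall>r s. (r, 1) \<in> skyline \<alpha> \<and> (s, 1) \<in> skyline \<alpha> \<and> r < s \<longrightarrow> T (r, 1) < T (s, 1))"

definition QK3 :: "comp \<Rightarrow> filling \<Rightarrow> bool" where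
  "QK3 \<alpha> T \<longleftrightarrow>
     (\<forall>r s c. (r, c) \<in> skyline \<alpha> \<and> (s, c) \<in> skyline \<alpha> \<and> s < r \<and> T (r, c) < T (s, c) \<longrightarrow>
        (s, c + 1) \<in> skyline \<alpha> \<and> T (r, c) < T (s, c + 1))"

definition QK4 :: "comp \<Rightarrow> filling \<Rightarrow> bool" where
  "QK4 \<alpha> T \<longleftrightarrow>
     (\<forall>r s c. r < s \<and> (r, c) \<in> skyline \<alpha> \<and> (s, c + 1) \<in> skyline \<alpha> \<and> \<alpha> ! (r - 1) < \<alpha> ! (s - 1) \<longrightarrow>
        T (r, c) < T (s, c + 1))"

text \<open>
  Fillings are extensional functions (\<open>undefined\<close> outside the diagram), so that each filling of
  the boxes is represented exactly once.
\<close>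

definition qKT :: "comp \<Rightarrow> filling set" where
  "qKT \<alpha> = {T \<in> skyline \<alpha> \<rightarrow>\<^sub>E {1..}. QK1 \<alpha> T \<and> QK2 \<alpha> T \<and> QK3 \<alpha> T \<and> QK4 \<alpha> T}"

lemma finite_qKT: "finite (qKT \<alpha>)"
proof (rule finite_subset)
  show "qKT \<alpha> \<subseteq> (\<Pi>\<^sub>E b\<in>skyline \<alpha>. {1..fst b})"
    by (auto simp: qKT_def QK1_def PiE_iff extensional_def)
  show "finite (\<Pi>\<^sub>E b\<in>skyline \<alpha>. {1..fst b})"
    by (intro finite_PiE finite_skyline) auto
qed

lift_definition weight :: "comp \<Rightarrow> filling \<Rightarrow> (nat \<Rightarrow>\<^sub>0 nat)" is
  "\<lambda>\<alpha> T i. card {b \<in> skyline \<alpha>. T b = i}"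
proof -
  fix \<alpha> and T :: filling
  have "{i. card {b \<in> skyline \<alpha>. T b = i} \<noteq> 0} \<subseteq> T ` skyline \<alpha>"
    by (auto simp: card_eq_0_iff)
  then show "finite {i. card {b \<in> skyline \<alpha>. T b = i} \<noteq> 0}"
    by (rule finite_subset) (simp add: finite_skyline)
qed

text \<open>
  Polynomials in the variables \<open>x\<^sub>0, x\<^sub>1, x\<^sub>2, \<dots>\<close> with integer coefficients: the monomial with
  exponent vector \<open>m\<close> is \<open>Poly_Mapping.single m 1\<close>, and \<open>Poly_Mapping.lookup p m\<close> is its coefficient in \<open>p\<close>.
  The variable \<open>x\<^sub>0\<close> never occurs, since the entries of tableaux are positive.
\<close>

type_synonym mpoly_int = "(nat \<Rightarrow>\<^sub>0 nat) \<Rightarrow>\<^sub>0 int"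

definition quasi_key :: "comp \<Rightarrow> mpoly_int" where
  "quasi_key \<alpha> = (\<Sum>T\<in>qKT \<alpha>. Poly_Mapping.single (weight \<alpha> T) 1)"

definition multiplicity_free :: "mpoly_int \<Rightarrow> bool" where
  "multiplicity_free p \<longleftrightarrow> (\<forall>m. Poly_Mapping.lookup p m \<in> {0, 1})"

inductive left_swap :: "comp \<Rightarrow> comp \<Rightarrow> bool" where
  "i < j \<Longrightarrow> j < length \<alpha> \<Longrightarrow> \<alpha> ! i < \<alpha> ! j \<Longrightarrow> left_swap \<alpha> (\<alpha>[i := \<alpha> ! j, j := \<alpha> ! i])"

definition lswap :: "comp \<Rightarrow> comp set" where
  "lswap \<alpha> = {\<beta>. left_swap\<^sup>*\<^sup>* \<alpha> \<beta>}"

definition flat :: "comp \<Rightarrow> comp" where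
  "flat \<alpha> = filter (\<lambda>a. a \<noteq> 0) \<alpha>"

text \<open>Dominance compares compositions of the same length only.\<close>

definition dom_le :: "comp \<Rightarrow> comp \<Rightarrow> bool" where
  "dom_le \<beta> \<alpha> \<longleftrightarrow> length \<beta> = length \<alpha> \<and>
     (\<forall>t\<in>{1..length \<alpha>}. (\<Sum>i<t. \<beta> ! i) \<le> (\<Sum>i<t. \<alpha> ! i))"

definition Qlswap :: "comp \<Rightarrow> comp set" where
  "Qlswap \<alpha> = {\<gamma> \<in> lswap \<alpha>. \<forall>\<tau>\<in>lswap \<alpha>. flat \<gamma> = flat \<tau> \<longrightarrow> dom_le \<gamma> \<tau>}"

end

theory Submission
  imports Defs
begin

text \<open>
  It suffices that a quasi-key tableau \<open>T\<close> of shape \<open>\<beta>\<close> can be recovered from its weight.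

  The pattern conditions say that \<open>\<beta>\<close> has few ascents: no three parts increase from left to right,
  and two parts followed by two parts that are larger than both of them occur only in the shape
  \<open>x, x, x + 1, x + 1\<close>. These two conditions together survive left swaps (the first would not do so
  alone), so they hold for all of \<open>lswap \<alpha>\<close>.

  Their effect on tableaux is this. Suppose that row \<open>i\<close> has an entry at most \<open>v\<close> in column \<open>c\<close>, where
  \<open>v < i\<close> and row \<open>v\<close> reaches column \<open>c\<close>. Among the rows up to \<open>v\<close>, at least one must be too short for
  column \<open>c\<close>, since otherwise these rows use up the values \<open>1, \<dots>, v\<close>; and by the pattern
  conditions (together with the fourth tableau condition in the exceptional shape) at most one is
  (\<open>one_short_row\<close>). Hence the rows up to \<open>v\<close> and row \<open>i\<close> have exactly \<open>v\<close> boxes in column \<open>c\<close>, and they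
  carry each of the values \<open>1, \<dots>, v\<close> once (\<open>column_covers\<close>).

  Now \<open>T\<close> is recovered one value at a time, from the largest value down. Suppose that all boxes with
  entries above \<open>v\<close> are known. The boxes with entry \<open>v\<close> lie in row \<open>v\<close>, where they form an initial
  segment, and in higher rows.

  If some row below \<open>v\<close> is shorter than row \<open>v\<close>, then no higher row is longer than row \<open>v\<close>. Call a
  column passed if it has an entry at most \<open>v\<close> in a row above \<open>v\<close>; these columns are known. By
  \<open>column_covers\<close>, the value \<open>v\<close> occurs once in each passed column, either in row \<open>v\<close> or above.
  So the boxes of \<open>v\<close> depend only on the length \<open>A\<close> of the initial segment in row \<open>v\<close>, and their number
  is that of the columns in \<open>{1..A}\<close> or passed. Two lengths \<open>A < B\<close> with the same number would require
  column \<open>B\<close> to be passed, which is impossible for a segment that ends there: either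
  \<open>column_covers\<close> or the third tableau condition (\<open>own_value_continues\<close>) forces one more \<open>v\<close>.

  If no row below \<open>v\<close> is shorter, then row \<open>v\<close> is filled with \<open>v\<close>. If several higher rows have entries
  at most \<open>v\<close>, then in all of them but the lowest these entries are \<open>v\<close>
  (\<open>second_row_value\<close>), so the number of entries \<open>v\<close> fixes how many go into the lowest one.
\<close>

section \<open>Compositions with few ascents\<close>

definition no_double_ascent :: "nat \<Rightarrow> (nat \<Rightarrow> nat) \<Rightarrow> bool" where
 "no_double_ascent N a \<longleftrightarrow> (\<forall>k<N. \<forall>j<k. \<forall>i<j. a i < a j \<longrightarrow> a k \<le> a j)"
definition tight_ascent_pairs :: "nat \<Rightarrow> (nat \<Rightarrow> nat) \<Rightarrow> bool" where
 "tight_ascent_pairs N a \<longleftrightarrow> (\<forall>s<N. \<forall>r<s. \<forall>q<r. \<forall>p<q.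
    a p < a r \<and> a p < a s \<and> a q < a r \<and> a q < a s \<longrightarrow>
    a p = a q \<and> a r = Suc (a q) \<and> a s = Suc (a q))"

text \<open>Occurrences of a pattern given by the list of their positions; this suits concrete patterns.\<close>

lemma contains_patternI:
  assumes "sorted_wrt (<) js" "length js = length \<beta>" "set js \<subseteq> {..<length \<alpha>}"
    and "\<forall>s<length \<beta>. \<forall>t<length \<beta>. (\<alpha> ! (js ! s) \<le> \<alpha> ! (js ! t) \<longleftrightarrow> \<beta> ! s \<le> \<beta> ! t) \<and>
           \<bar>int (\<alpha> ! (js ! s)) - int (\<alpha> ! (js ! t))\<bar> \<ge> \<bar>int (\<beta> ! s) - int (\<beta> ! t)\<bar>"
  shows "contains_pattern \<alpha> \<beta>"
  unfolding contains_pattern_def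
proof (intro exI conjI)
  show "strict_mono_on {..<length \<beta>} ((!) js)"
    using assms(1,2) by (auto simp: strict_mono_on_def sorted_wrt_iff_nth_less)
  show "(!) js ` {..<length \<beta>} \<subseteq> {..<length \<alpha>}"
    using assms(2,3) nth_mem by (fastforce simp flip: assms(2))
qed (rule assms(4))

lemma KM_bar_ge1_no_double_ascent:
  assumes "\<alpha> \<in> KM_bar_ge1 n"
  shows "no_double_ascent (length \<alpha>) ((!) \<alpha>)"
  unfolding no_double_ascent_def
proof (intro allI impI, rule ccontr)
  fix i j k assume "k < length \<alpha>" "j < k" "i < j" "\<alpha> ! i < \<alpha> ! j" "\<not> \<alpha> ! k \<le> \<alpha> ! j"
  then have "contains_pattern \<alpha> [0,1,2]"
    by (intro contains_patternI[of "[i, j, k]"]) (auto simp: less_Suc_eq)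
  then show False using assms by (auto simp: KM_bar_ge1_def)
qed

text \<open>
  Absence of double ascents orders each of the two pairs weakly downwards. The four combinations of
  equality and strict descent are the four forbidden patterns of length \<open>4\<close>; only for two
  equalities is the gap of size \<open>2\<close> in the pattern a restriction, and this is where the exceptional
  shape comes from.
\<close>

lemma KM_bar_ge1_tight_ascent_pairs:
  assumes "\<alpha> \<in> KM_bar_ge1 n"
  shows "tight_ascent_pairs (length \<alpha>) ((!) \<alpha>)"
  unfolding tight_ascent_pairs_def
proof (intro allI impI, elim conjE, rule ccontr)
  fix p q r s assume pos: "s < length \<alpha>" "r < s" "q < r" "p < q"
    and lt: "\<alpha> ! p < \<alpha> ! r" "\<alpha> ! p < \<alpha> ! s" "\<alpha> ! q < \<alpha> ! r" "\<alpha> ! q < \<alpha> ! s"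
    and ne: "\<not> (\<alpha> ! p = \<alpha> ! q \<and> \<alpha> ! r = Suc (\<alpha> ! q) \<and> \<alpha> ! s = Suc (\<alpha> ! q))"
  have "\<alpha> ! q \<le> \<alpha> ! p" "\<alpha> ! s \<le> \<alpha> ! r"
    using KM_bar_ge1_no_double_ascent[OF assms] pos lt unfolding no_double_ascent_def
    by (meson less_trans not_le)+
  then consider "\<alpha> ! p = \<alpha> ! q" "\<alpha> ! r = \<alpha> ! s" | "\<alpha> ! p = \<alpha> ! q" "\<alpha> ! s < \<alpha> ! r"
    | "\<alpha> ! q < \<alpha> ! p" "\<alpha> ! s < \<alpha> ! r" | "\<alpha> ! q < \<alpha> ! p" "\<alpha> ! r = \<alpha> ! s" by linarith
  then have "\<exists>\<pi>\<in>{[0,0,2,2], [0,0,2,1], [1,0,3,2], [1,0,2,2]}. contains_pattern \<alpha> \<pi>"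
  proof cases
    case 1
    then have "contains_pattern \<alpha> [0,0,2,2]"
      using pos lt ne by (intro contains_patternI[of "[p, q, r, s]"]) (auto simp: less_Suc_eq)
    then show ?thesis by blast
  next
    case 2
    then have "contains_pattern \<alpha> [0,0,2,1]"
      using pos lt by (intro contains_patternI[of "[p, q, r, s]"]) (auto simp: less_Suc_eq)
    then show ?thesis by blast
  next
    case 3
    then have "contains_pattern \<alpha> [1,0,3,2]"
      using pos lt by (intro contains_patternI[of "[p, q, r, s]"]) (auto simp: less_Suc_eq)
    then show ?thesis by blast
  next
    case 4
    then have "contains_pattern \<alpha> [1,0,2,2]"
      using pos lt by (intro contains_patternI[of "[p, q, r, s]"]) (auto simp: less_Suc_eq)
    then show ?thesis by blast
  qed
  then show False using assms by (auto simp: KM_bar_ge1_def)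
qed

text \<open>
  When the middle entry of a double ascent comes from the swap, undoing the swap can turn its three
  positions and the other swapped one into two low parts followed by two high ones; this is where the
  condition on pairs enters.
\<close>

lemma no_double_ascent_swap:
  assumes "no_double_ascent N a" "tight_ascent_pairs N a" "i < j" "j < N" "a i < a j"
  shows "no_double_ascent N (a(i := a j, j := a i))"
  unfolding no_double_ascent_def
proof (intro allI impI)
  fix p q r let ?b = "a(i := a j, j := a i)"
  assume *: "r < N" "q < r" "p < q" and lt: "?b p < ?b q"
  have c: "\<And>i j k. i<j \<Longrightarrow> j<k \<Longrightarrow> k<N \<Longrightarrow> a i < a j \<Longrightarrow> a k \<le> a j"
    using assms(1) by (auto simp: no_double_ascent_def)
  have d: "\<And>p q r s. p<q \<Longrightarrow> q<r \<Longrightarrow> r < s \<Longrightarrow> s<N \<Longrightarrow> a p < a r \<Longrightarrow> a p < a s \<Longrightarrow>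
      a q < a r \<Longrightarrow> a q < a s \<Longrightarrow> a p = a q \<and> a r = Suc (a q) \<and> a s = Suc (a q)"
    using assms(2) unfolding tight_ascent_pairs_def by blast
  show "?b r \<le> ?b q"
  proof (rule ccontr)
    assume "\<not> ?b r \<le> ?b q"
    then have lt': "?b q < ?b r" by simp
    consider "q = i" | "q = j" | "q \<noteq> i" "q \<noteq> j" "p = j" | "q \<noteq> i" "q \<noteq> j" "r = i"
      | "q \<noteq> i" "q \<noteq> j" "p \<noteq> j" "r \<noteq> i" by blast
    then show False
    proof cases
      case 1
      then show False using c[of p j r] d[of p q r j] * lt lt' assms(3-5)
        by (cases r j rule: linorder_cases) auto
    next
      case 2
      then show False using c[of p i r] d[of i p q r] * lt lt' assms(3-5)
        by (cases p i rule: linorder_cases) auto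
    next
      case 3
      then show False using c[of i q r] * lt lt' assms(3-5) by auto
    next
      case 4
      then show False using c[of p q j] * lt lt' assms(3-5) by auto
    next
      case 5
      then show False using c[of p q r] * lt lt' assms(3-5) by (auto split: if_splits)
    qed
  qed
qed

text \<open>
  A swap raises the part at \<open>i\<close> and lowers the part at \<open>j\<close>. Unless \<open>i\<close> is one of the two high
  positions or \<open>j\<close> one of the two low ones, the pairs were at least as far apart before the swap, and the
  condition at the same positions gives the claim. Otherwise the value of that part is traced back to
  the place from which it came.
\<close>

lemma tight_ascent_pairs_swap:
  assumes "tight_ascent_pairs N a" "i < j" "j < N" "a i < a j"
  shows "tight_ascent_pairs N (a(i := a j, j := a i))"
  unfolding tight_ascent_pairs_def
proof (intro allI impI)
  let ?b = "a(i := a j, j := a i)"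
  fix p q r s assume *: "s < N" "r < s" "q < r" "p < q"
    and lt: "?b p < ?b r \<and> ?b p < ?b s \<and> ?b q < ?b r \<and> ?b q < ?b s"
  have d: "\<And>p q r s. p<q \<Longrightarrow> q<r \<Longrightarrow> r < s \<Longrightarrow> s<N \<Longrightarrow> a p < a r \<Longrightarrow> a p < a s \<Longrightarrow>
      a q < a r \<Longrightarrow> a q < a s \<Longrightarrow> a p = a q \<and> a r = Suc (a q) \<and> a s = Suc (a q)"
    using assms(1) unfolding tight_ascent_pairs_def by blast
  have lt': "?b p < ?b r" "?b p < ?b s" "?b q < ?b r" "?b q < ?b s" using lt by auto
  have up: "a x \<le> ?b x" if "x \<noteq> j" for x using that assms by auto
  have dn: "?b x \<le> a x" if "x \<noteq> i" for x using that assms by auto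
  consider "r \<noteq> i" "s \<noteq> i" "p \<noteq> j" "q \<noteq> j" | "r = i" | "s = i" | "p = j" | "q = j" by blast
  then show "?b p = ?b q \<and> ?b r = Suc (?b q) \<and> ?b s = Suc (?b q)"
  proof cases
    case 1
    then show ?thesis using d[of p q r s] * lt' up[of p] up[of q] dn[of r] dn[of s] by linarith
  next
    case 2
    then show ?thesis using d[of p q r s] d[of p q j s] d[of p q s j] * lt' assms(2-4)
      by (cases s j rule: linorder_cases) auto
  next
    case 3
    then show ?thesis using d[of p q r j] * lt' assms(2-4) by auto
  next
    case 4
    then show ?thesis using d[of i q r s] * lt' assms(2-4) by auto
  next
    case 5
    then show ?thesis using d[of p q r s] d[of i p r s] d[of p i r s] * lt' assms(2-4)
      by (cases p i rule: linorder_cases) auto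
  qed
qed

section \<open>Columns of tableaux with few ascents\<close>

locale tame_shape =
  fixes \<beta> :: comp
  assumes parts_pos: "\<And>i. i < length \<beta> \<Longrightarrow> 1 \<le> \<beta> ! i"
    and double: "no_double_ascent (length \<beta>) ((!) \<beta>)"
    and pairs: "tight_ascent_pairs (length \<beta>) ((!) \<beta>)"
begin

definition len :: "nat \<Rightarrow> nat" where "len i = \<beta> ! (i - 1)"

abbreviation "n \<equiv> length \<beta>"

lemma cell_iff: "(i, c) \<in> skyline \<beta> \<longleftrightarrow> 1 \<le> i \<and> i \<le> n \<and> 1 \<le> c \<and> c \<le> len i"
  by (auto simp: skyline_def len_def)

lemma len_pos: "1 \<le> i \<Longrightarrow> i \<le> n \<Longrightarrow> 1 \<le> len i"
  using parts_pos[of "i - 1"] by (simp add: len_def)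

lemma no_double_ascent_rows:
  assumes "1 \<le> i" "i < j" "j < k" "k \<le> n" "len i < len j"
  shows "len k \<le> len j"
proof -
  have "k - 1 < n" "j - 1 < k - 1" "i - 1 < j - 1"
    using assms by linarith+
  then show ?thesis
    using double assms(5) unfolding no_double_ascent_def len_def by blast
qed

lemma tight_rows:
  assumes "1 \<le> p" "p < q" "q < r" "r < s" "s \<le> n"
    and "len p < len r" "len p < len s" "len q < len r" "len q < len s"
  shows "len p = len q" "len r = Suc (len q)" "len s = Suc (len q)"
proof -
  have "s - 1 < n" "r - 1 < s - 1" "q - 1 < r - 1" "p - 1 < q - 1"
    using assms by linarith+
  then show "len p = len q" "len r = Suc (len q)" "len s = Suc (len q)"
    using pairs assms(6-) unfolding tight_ascent_pairs_def len_def by blast+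
qed

context
  fixes T assumes T: "T \<in> qKT \<beta>"
begin

lemma entry_pos: "b \<in> skyline \<beta> \<Longrightarrow> 1 \<le> T b"
  using T by (auto simp: qKT_def PiE_iff)

lemma entry_le: "(i, c) \<in> skyline \<beta> \<Longrightarrow> T (i, c) \<le> i"
  using T by (auto simp: qKT_def QK1_def)

lemma row_decreasing:
  assumes "c \<le> c'" "(i, c) \<in> skyline \<beta>" "(i, c') \<in> skyline \<beta>"
  shows "T (i, c') \<le> T (i, c)"
  using assms
proof (induction rule: dec_induct)
  case (step m)
  then have "(i, m) \<in> skyline \<beta>" by (auto simp: cell_iff)
  moreover have "T (i, m + 1) \<le> T (i, m)"
    using T step.prems calculation by (auto simp: qKT_def QK1_def)
  ultimately show ?case using step by simp
qed simp

lemma column_inj: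
  "(r, c) \<in> skyline \<beta> \<Longrightarrow> (s, c) \<in> skyline \<beta> \<Longrightarrow> T (r, c) = T (s, c) \<Longrightarrow> r = s"
  using T by (auto simp: qKT_def QK2_def)

lemma inversion:
  "(r, c) \<in> skyline \<beta> \<Longrightarrow> (s, c) \<in> skyline \<beta> \<Longrightarrow> s < r \<Longrightarrow> T (r, c) < T (s, c) \<Longrightarrow>
    (s, c + 1) \<in> skyline \<beta> \<and> T (r, c) < T (s, c + 1)"
  using T unfolding qKT_def QK3_def by blast

lemma ascent:
  "r < s \<Longrightarrow> (r, c) \<in> skyline \<beta> \<Longrightarrow> (s, c + 1) \<in> skyline \<beta> \<Longrightarrow> len r < len s \<Longrightarrow>
    T (r, c) < T (s, c + 1)"
  using T unfolding qKT_def QK4_def len_def by blast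

text \<open>
  Row \<open>k\<close> may only use the values \<open>1, \<dots>, k\<close>, and by induction the lower rows have taken all but \<open>k\<close>.
\<close>

lemma full_column:
  assumes "v \<le> n" "1 \<le> c" "\<forall>k\<in>{1..v}. c \<le> len k" "k \<in> {1..v}"
  shows "T (k, c) = k"
  using assms(4)
proof (induction k rule: less_induct)
  case (less k)
  have cells: "(j, c) \<in> skyline \<beta>" if "j \<in> {1..v}" for j
    using that assms by (auto simp: cell_iff)
  have "1 \<le> T (k, c)" "T (k, c) \<le> k"
    using entry_pos entry_le cells less.prems by blast+
  moreover have "\<not> T (k, c) < k"
  proof
    assume *: "T (k, c) < k"
    then have "T (T (k, c), c) = T (k, c)"
      using less calculation by auto
    then show False
      using column_inj[of "T (k, c)" c k] cells less.prems * calculation by auto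
  qed
  ultimately show ?case by simp
qed

text \<open>
  Two rows below \<open>v\<close> that miss column \<open>c\<close>, followed by the rows \<open>v\<close> and \<open>i\<close> that reach it, can only
  have lengths \<open>x, x, x + 1, x + 1\<close> with \<open>c = x + 1\<close>. In that case column \<open>x\<close> is full up to row \<open>v\<close>, so
  the topmost short row \<open>d\<close> has the entry \<open>d\<close> there, and the fourth tableau condition makes the
  entries of column \<open>c\<close> in all longer rows above \<open>d\<close> exceed \<open>d\<close>. The rows \<open>d + 1, \<dots>, v\<close> then leave
  no value at most \<open>v\<close> for row \<open>i\<close>.
\<close>

lemma one_short_row:
  assumes "1 \<le> v" "v < i" "i \<le> n" "1 \<le> c" "c \<le> len v" "c \<le> len i" "T (i, c) \<le> v"
  obtains k where "k \<in> {1..<v}" "len k < c" "\<forall>k'\<in>{1..v} - {k}. c \<le> len k'"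
proof -
  define S where "S = {k \<in> {1..v}. len k < c}"
  have icell: "(i, c) \<in> skyline \<beta>"
    using assms by (auto simp: cell_iff)
  have "S \<noteq> {}"
  proof
    assume "S = {}"
    then have full: "\<forall>k\<in>{1..v}. c \<le> len k" by (auto simp: S_def not_less)
    have val: "T (i, c) \<in> {1..v}" using entry_pos[OF icell] assms by auto
    then have "T (T (i, c), c) = T (i, c)"
      using full_column[OF _ _ full] assms by auto
    moreover have "(T (i, c), c) \<in> skyline \<beta>"
      using val full assms by (auto simp: cell_iff)
    ultimately show False
      using column_inj icell val assms by fastforce
  qed
  moreover have fin: "finite S" by (simp add: S_def)
  ultimately have d: "Max S \<in> S" by simp
  define d where "d = Max S"
  have dS: "d \<in> {1..v}" "len d < c" using d by (auto simp: d_def S_def)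
  have dv: "d < v" using dS assms by (cases "d = v") auto
  \<comment> \<open>a second short row would lie below \<open>d\<close> and lead to the exceptional shape\<close>
  have "k = d" if k: "k \<in> S" for k
  proof (rule ccontr)
    assume "k \<noteq> d"
    have eqs: "len j = len d \<and> len v = Suc (len d) \<and> len i = Suc (len d)" if "j \<in> S" "j \<noteq> d" for j
    proof -
      have "j < d" using that Max_ge[OF fin that(1)] by (auto simp: d_def)
      moreover have "1 \<le> j" "len j < c" using that by (auto simp: S_def)
      ultimately show ?thesis
        using tight_rows[of j d v i] dS dv assms by auto
    qed
    define x where "x = len d"
    have c: "c = x + 1"
      using eqs[OF k \<open>k \<noteq> d\<close>] assms dS by (simp add: x_def)
    have "1 \<le> x" using len_pos[of d] dS dv assms by (simp add: x_def)
    have "x \<le> len j" if "j \<in> {1..v}" for j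
      using that eqs[of j] c by (cases "j = d"; cases "j \<in> S") (auto simp: S_def x_def)
    then have Td: "T (d, x) = d"
      using full_column[of v x d] \<open>1 \<le> x\<close> dS assms by auto
    let ?R = "insert i {d<..v}"
    have long: "c \<le> len s" if "s \<in> ?R" for s
    proof (cases "s = i")
      case False
      then have "s \<notin> S" using that Max_ge[OF fin, of s] by (auto simp: d_def)
      then show ?thesis using that False by (auto simp: S_def)
    qed (use assms in simp)
    have cells: "(s, c) \<in> skyline \<beta>" if "s \<in> ?R" for s
      using that long[OF that] assms by (auto simp: cell_iff)
    have "T (s, c) \<in> {d<..v}" if s: "s \<in> ?R" for s
    proof -
      have "T (d, x) < T (s, x + 1)"
        using ascent[of d s x] cells[OF s] long[OF s] s c dS dv assms \<open>1 \<le> x\<close>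
        by (auto simp: cell_iff x_def)
      then show ?thesis using Td c entry_le[OF cells[OF s]] s assms by auto
    qed
    then have "(\<lambda>s. T (s, c)) ` ?R \<subseteq> {d<..v}" by blast
    moreover have "inj_on (\<lambda>s. T (s, c)) ?R"
      using cells column_inj by (intro inj_onI) blast
    ultimately have "card ?R \<le> card {d<..v}"
      by (intro card_inj_on_le) auto
    then show False using assms by simp
  qed
  then have "\<forall>k'\<in>{1..v} - {d}. c \<le> len k'" by (auto simp: S_def not_less[symmetric])
  then show ?thesis using that[of d] dS dv by auto
qed

text \<open>
  With a single short row, the boxes of column \<open>c\<close> in the rows up to \<open>v\<close> and in row \<open>i\<close> are as many as
  the values available to them. The bound \<open>u \<le> r\<close> holds as row \<open>r\<close> has no entries above \<open>r\<close>; for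
  \<open>u = v\<close> it shows that \<open>v\<close> occurs in row \<open>i\<close> or in row \<open>v\<close>.
\<close>

lemma column_covers:
  assumes "1 \<le> v" "v < i" "i \<le> n" "1 \<le> c" "c \<le> len v" "c \<le> len i" "T (i, c) \<le> v"
    and "u \<in> {1..v}"
  shows "T (i, c) = u \<or> (\<exists>r\<in>{u..v}. (r, c) \<in> skyline \<beta> \<and> T (r, c) = u)"
proof -
  obtain k where k: "k \<in> {1..<v}" "len k < c" "\<forall>k'\<in>{1..v} - {k}. c \<le> len k'"
    using one_short_row assms by metis
  let ?R = "insert i ({1..v} - {k})"
  have cells: "(s, c) \<in> skyline \<beta>" if "s \<in> ?R" for s
    using that k assms by (auto simp: cell_iff)
  have inj: "inj_on (\<lambda>s. T (s, c)) ?R"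
    using cells column_inj by (intro inj_onI) blast
  have "(\<lambda>s. T (s, c)) ` ?R \<subseteq> {1..v}"
    using entry_pos entry_le cells assms by fastforce
  moreover have "card ((\<lambda>s. T (s, c)) ` ?R) = v"
    using card_image[OF inj] k assms by simp
  ultimately have "(\<lambda>s. T (s, c)) ` ?R = {1..v}"
    by (intro card_subset_eq) simp_all
  then have "u \<in> (\<lambda>s. T (s, c)) ` ?R" using assms(8) by (rule ssubst)
  then obtain s where s: "s \<in> ?R" "T (s, c) = u" by blast
  then show ?thesis using cells[OF s(1)] entry_le[of s c] by (cases "s = i") auto
qed

text \<open>
  Let \<open>x\<close> be the last entry of row \<open>i\<close>. All values in \<open>{x<..v}\<close> occur in that column in rows up to \<open>v\<close>,
  so by the third tableau condition each of these rows has a further entry above \<open>x\<close>. These entries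
  are distinct and lie in \<open>{x<..v}\<close>, hence exhaust it; the one equal to \<open>v\<close> must be in row \<open>v\<close>.
\<close>

lemma own_value_continues:
  assumes "1 \<le> v" "v < i" "i \<le> n" "1 \<le> c" "c \<le> len v" "c = len i"
    and "T (v, c) = v" "T (i, c) < v"
  shows "(v, c + 1) \<in> skyline \<beta> \<and> T (v, c + 1) = v"
proof -
  define x where "x = T (i, c)"
  have icell: "(i, c) \<in> skyline \<beta>" using assms by (auto simp: cell_iff)
  have "\<forall>u\<in>{x<..v}. \<exists>r. r \<in> {u..v} \<and> (r, c) \<in> skyline \<beta> \<and> T (r, c) = u"
  proof
    fix u assume u: "u \<in> {x<..v}"
    have "T (i, c) = u \<or> (\<exists>r\<in>{u..v}. (r, c) \<in> skyline \<beta> \<and> T (r, c) = u)"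
      using assms u by (intro column_covers) (auto simp: x_def)
    then show "\<exists>r. r \<in> {u..v} \<and> (r, c) \<in> skyline \<beta> \<and> T (r, c) = u"
      using u by (auto simp: x_def)
  qed
  then obtain r where r: "\<And>u. u \<in> {x<..v} \<Longrightarrow> r u \<in> {u..v} \<and> (r u, c) \<in> skyline \<beta> \<and> T (r u, c) = u"
    by metis
  have next_cell: "(r u, c + 1) \<in> skyline \<beta>" "T (r u, c + 1) \<in> {x<..u}" if u: "u \<in> {x<..v}" for u
  proof -
    have *: "(r u, c + 1) \<in> skyline \<beta> \<and> x < T (r u, c + 1)"
      using inversion[OF icell, of "r u"] r[OF u] u assms by (auto simp: x_def)
    then show "(r u, c + 1) \<in> skyline \<beta>" by simp
    show "T (r u, c + 1) \<in> {x<..u}"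
      using * row_decreasing[of c "c + 1" "r u"] r[OF u] by auto
  qed
  have "inj_on (\<lambda>u. T (r u, c + 1)) {x<..v}"
  proof (rule inj_onI)
    fix u w assume uw: "u \<in> {x<..v}" "w \<in> {x<..v}" "T (r u, c + 1) = T (r w, c + 1)"
    then have "r u = r w" using column_inj next_cell by blast
    then show "u = w" using r uw by metis
  qed
  moreover have "(\<lambda>u. T (r u, c + 1)) ` {x<..v} \<subseteq> {x<..v}" using next_cell by fastforce
  ultimately have "(\<lambda>u. T (r u, c + 1)) ` {x<..v} = {x<..v}"
    by (intro endo_inj_surj) auto
  moreover have "v \<in> {x<..v}" using assms by (simp add: x_def)
  ultimately have "v \<in> (\<lambda>u. T (r u, c + 1)) ` {x<..v}" by (rule ssubst)
  then obtain u where u: "u \<in> {x<..v}" "T (r u, c + 1) = v" by blast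
  then have "u = v" using next_cell(2)[of u] by auto
  then have "r u = v" using r[OF u(1)] by auto
  then show ?thesis using u next_cell by auto
qed

end

section \<open>Recovering the boxes of one value\<close>

definition own :: "filling \<Rightarrow> nat \<Rightarrow> nat set" where
  "own T v = {c. (v, c) \<in> skyline \<beta> \<and> T (v, c) = v}"

definition passed :: "filling \<Rightarrow> nat \<Rightarrow> nat set" where
  "passed T v = {c. \<exists>i>v. (i, c) \<in> skyline \<beta> \<and> T (i, c) \<le> v}"

lemma own_down:
  assumes T: "T \<in> qKT \<beta>" and "c' \<in> own T v" "1 \<le> c" "c \<le> c'"
  shows "c \<in> own T v"
proof -
  have cells: "(v, c') \<in> skyline \<beta>" "(v, c) \<in> skyline \<beta>" "T (v, c') = v" 
    using assms by (auto simp: own_def cell_iff)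
  then show ?thesis
    using row_decreasing[OF T assms(4) cells(2,1)] entry_le[OF T cells(2)] by (auto simp: own_def)
qed

lemma finite_own: "finite (own T v)"
  by (rule finite_subset[of _ "{..len v}"]) (auto simp: own_def cell_iff)

lemma finite_passed: "finite (passed T v)"
  by (rule finite_subset[OF _ finite_imageI[OF finite_skyline[of \<beta>], of snd]]) (force simp: passed_def)

text \<open>
  For a row \<open>v\<close> with a shorter row \<open>k\<close> below it, a longer row above \<open>v\<close> would complete a double ascent.
  So \<open>column_covers\<close> applies to all boxes above row \<open>v\<close> with entries at most \<open>v\<close>.
\<close>

lemma high_row_value:
  assumes T: "T \<in> qKT \<beta>" and v: "k \<in> {1..<v}" "len k < len v" "v < i" "(i, c) \<in> skyline \<beta>"
  shows "T (i, c) = v \<longleftrightarrow> T (i, c) \<le> v \<and> c \<notin> own T v"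
    and "c \<le> len v"
proof -
  have i: "i \<le> n" "1 \<le> c" "c \<le> len i" using v by (auto simp: cell_iff)
  show cv: "c \<le> len v" using no_double_ascent_rows[of k v i] v i by auto
  then have vcell: "(v, c) \<in> skyline \<beta>" using v i by (auto simp: cell_iff)
  have "T (v, c) = v" if "T (i, c) \<le> v" "T (i, c) \<noteq> v"
    using column_covers[OF T, of v i c v] v i cv that by auto
  then show "T (i, c) = v \<longleftrightarrow> T (i, c) \<le> v \<and> c \<notin> own T v"
    using column_inj[OF T vcell v(4)] v vcell by (auto simp: own_def)
qed

lemma high_row_count:
  assumes T: "T \<in> qKT \<beta>" and v: "k \<in> {1..<v}" "len k < len v" "v \<le> n"
  shows "card {b \<in> skyline \<beta>. T b = v} = card (own T v \<union> passed T v)"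
proof -
  have "inj_on snd {b \<in> skyline \<beta>. T b = v}"
    using column_inj[OF T] by (auto simp: inj_on_def)
  moreover have "snd ` {b \<in> skyline \<beta>. T b = v} = own T v \<union> passed T v"
  proof (intro equalityI subsetI)
    fix c assume "c \<in> snd ` {b \<in> skyline \<beta>. T b = v}"
    then obtain i where i: "(i, c) \<in> skyline \<beta>" "T (i, c) = v" by auto
    then have "v \<le> i" using entry_le[OF T] by blast
    then consider "i = v" | "v < i" by linarith
    then show "c \<in> own T v \<union> passed T v"
    proof cases
      case 1
      then show ?thesis using i by (auto simp: own_def)
    next
      case 2
      then have "c \<in> passed T v" using i unfolding passed_def by (intro CollectI exI[of _ i]) simp
      then show ?thesis by simp
    qed
  next
    fix c assume c: "c \<in> own T v \<union> passed T v"
    show "c \<in> snd ` {b \<in> skyline \<beta>. T b = v}"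
    proof (cases "c \<in> own T v")
      case True
      then show ?thesis by (force simp: own_def)
    next
      case False
      then obtain i where i: "v < i" "(i, c) \<in> skyline \<beta>" "T (i, c) \<le> v"
        using c by (auto simp: passed_def)
      then have "T (i, c) = v" using high_row_value[OF T v(1,2)] False by blast
      then show ?thesis using i by force
    qed
  qed
  ultimately show ?thesis by (metis card_image)
qed

text \<open>
  Equal counts force every column in which \<open>own U v\<close> exceeds \<open>own T v\<close> to be passed, in particular the
  last column \<open>c\<close> of \<open>own U v\<close>. In a row \<open>i\<close> witnessing this, the entry of \<open>U\<close> is below \<open>v\<close>, and then
  column \<open>c + 1\<close> belongs to \<open>own U v\<close> as well.
\<close>

lemma high_row_own_eq:
  assumes T: "T \<in> qKT \<beta>" and U: "U \<in> qKT \<beta>"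
    and v: "k \<in> {1..<v}" "len k < len v" "v \<le> n"
    and passed: "passed T v = passed U v"
    and card: "card {b \<in> skyline \<beta>. T b = v} = card {b \<in> skyline \<beta>. U b = v}"
    and sub: "own T v \<subseteq> own U v"
  shows "own T v = own U v"
proof (rule ccontr)
  assume ne: "own T v \<noteq> own U v"
  have "own T v \<union> passed T v = own U v \<union> passed U v"
    using high_row_count[OF T v] high_row_count[OF U v] card passed sub
    by (intro card_subset_eq) (auto simp: finite_own finite_passed)
  moreover define c where "c = Max (own U v)"
  have "own U v \<noteq> {}" using ne sub by auto
  then have cU: "c \<in> own U v" using finite_own by (simp add: c_def)
  then have c: "(v, c) \<in> skyline \<beta>" "U (v, c) = v" by (auto simp: own_def)
  have "c \<notin> own T v"
  proof
    assume "c \<in> own T v"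
    then have "own U v \<subseteq> own T v"
      using own_down[OF T] finite_own by (auto simp: c_def own_def cell_iff)
    then show False using ne sub by auto
  qed
  ultimately have "c \<in> passed U v" using cU passed by blast
  then obtain i where i: "v < i" "(i, c) \<in> skyline \<beta>" "U (i, c) \<le> v"
    by (auto simp: passed_def)
  have "U (i, c) \<noteq> v" using column_inj[OF U c(1) i(2)] c(2) i(1) by force
  then have lt: "U (i, c) < v" using i(3) by simp
  have "(v, c + 1) \<in> skyline \<beta> \<and> U (v, c + 1) = v"
  proof (cases "c = len i")
    case True
    then show ?thesis
      using own_value_continues[OF U, of v i c] c i lt by (auto simp: cell_iff)
  next
    case False
    then have next_cell: "(i, c + 1) \<in> skyline \<beta>" using i by (auto simp: cell_iff)
    then have lt': "U (i, c + 1) < v" using row_decreasing[OF U _ i(2) next_cell] lt by simp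
    have "c + 1 \<le> len v" using high_row_value(2)[OF U v(1,2) i(1) next_cell] .
    then have "(v, c + 1) \<in> skyline \<beta>" using c by (auto simp: cell_iff)
    moreover have "c + 1 \<in> own U v"
      using high_row_value(1)[OF U v(1,2) i(1) next_cell] lt' by auto
    ultimately show ?thesis by (auto simp: own_def)
  qed
  then have "c + 1 \<in> own U v" by (auto simp: own_def)
  then have "c + 1 \<le> c" unfolding c_def using finite_own by (intro Max_ge)
  then show False by simp
qed

lemma high_row_determined:
  assumes T: "T \<in> qKT \<beta>" and U: "U \<in> qKT \<beta>"
    and v: "k \<in> {1..<v}" "len k < len v" "v \<le> n"
    and agree: "\<And>b. b \<in> skyline \<beta> \<Longrightarrow> T b \<le> v \<longleftrightarrow> U b \<le> v"
    and card: "card {b \<in> skyline \<beta>. T b = v} = card {b \<in> skyline \<beta>. U b = v}"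
    and b: "b \<in> skyline \<beta>"
  shows "T b = v \<longleftrightarrow> U b = v"
proof -
  have passed: "passed T v = passed U v" using agree by (auto simp: passed_def)
  have "own T v \<subseteq> own U v \<or> own U v \<subseteq> own T v"
  proof (rule ccontr)
    assume "\<not> ?thesis"
    then obtain c d where cd: "c \<in> own T v" "c \<notin> own U v" "d \<in> own U v" "d \<notin> own T v" by blast
    then have "1 \<le> c" "1 \<le> d" by (auto simp: own_def cell_iff)
    then show False using own_down[OF T, of c v d] own_down[OF U, of d v c] cd by linarith
  qed
  then have own: "own T v = own U v"
    using high_row_own_eq[OF T U v passed card] high_row_own_eq[OF U T v passed[symmetric] card[symmetric]]
    by auto
  obtain i c where ic: "b = (i, c)" by (cases b)
  consider "i < v" | "i = v" | "v < i" by linarith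
  then show ?thesis
  proof cases
    case 1
    then show ?thesis using entry_le[OF T] entry_le[OF U] b ic by (metis leD)
  next
    case 2
    then show ?thesis using own b ic by (auto simp: own_def)
  next
    case 3
    then show ?thesis
      using high_row_value(1)[OF T v(1,2) 3] high_row_value(1)[OF U v(1,2) 3] own agree b ic by auto
  qed
qed

text \<open>The columns that row \<open>v\<close> reaches are full up to row \<open>v\<close>, so no small value is left for row \<open>i\<close>.\<close>

lemma low_row_small:
  assumes T: "T \<in> qKT \<beta>" and v: "1 \<le> v" "v \<le> n" "\<forall>k\<in>{1..v}. len v \<le> len k"
    and i: "v < i" "(i, c) \<in> skyline \<beta>" "T (i, c) \<le> v"
  shows "len v < c"
proof (rule ccontr)
  assume "\<not> len v < c"
  then have full: "\<forall>k\<in>{1..v}. c \<le> len k" using v by auto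
  have val: "T (i, c) \<in> {1..v}" using entry_pos[OF T i(2)] i by auto
  then have "T (T (i, c), c) = T (i, c)"
    using full_column[OF T _ _ full] i v by (auto simp: cell_iff)
  moreover have "(T (i, c), c) \<in> skyline \<beta>"
    using val full i v by (auto simp: cell_iff)
  ultimately show False
    using column_inj[OF T _ i(2)] val i by fastforce
qed

text \<open>
  Rows \<open>s\<close> and \<open>t\<close> are both longer than row \<open>v\<close>, so row \<open>t\<close> is not longer than row \<open>s\<close> and
  \<open>one_short_row\<close> applies with \<open>s\<close> in place of \<open>v\<close>: the only row up to \<open>s\<close> that misses column \<open>c\<close> is
  \<open>v\<close>. The rows below \<open>v\<close> then contain the values \<open>1, \<dots>, v - 1\<close>, and only \<open>v\<close> is left.
\<close>

lemma second_row_value: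
  assumes T: "T \<in> qKT \<beta>" and v: "1 \<le> v" "\<forall>k\<in>{1..v}. len v \<le> len k"
    and s: "v < s" "(s, c') \<in> skyline \<beta>" "T (s, c') \<le> v"
    and t: "s < t" "(t, c) \<in> skyline \<beta>" "T (t, c) \<le> v"
  shows "T (t, c) = v"
proof -
  have vn: "v \<le> n" using s by (auto simp: cell_iff)
  have "len v < c'" "len v < c"
    using low_row_small[OF T v(1) vn v(2) s]
      low_row_small[OF T v(1) vn v(2) less_trans[OF s(1) t(1)] t(2,3)] by auto
  then have lens: "len v < len s" "len v < c" "c \<le> len t" using s t by (auto simp: cell_iff)
  then have "len t \<le> len s"
    using no_double_ascent_rows[of v s t] s t v by (auto simp: cell_iff)
  then have "c \<le> len s" using lens by simp
  moreover have "1 \<le> s" "t \<le> n" "1 \<le> c" "T (t, c) \<le> s" using s t by (auto simp: cell_iff)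
  ultimately obtain k where k: "len k < c" "\<forall>k'\<in>{1..s} - {k}. c \<le> len k'"
    using one_short_row[OF T, of s t c] t(1) lens(3) by blast
  have "v \<in> {1..s}" using s v by simp
  then have "v = k" using k(2) lens(2) by (metis Diff_iff not_le singletonD)
  have full: "\<forall>k'\<in>{1..v - 1}. c \<le> len k'"
  proof
    fix k' assume "k' \<in> {1..v - 1}"
    then have "k' \<in> {1..s} - {k}" using \<open>v = k\<close> s by auto
    then show "c \<le> len k'" using k by blast
  qed
  show ?thesis
  proof (rule ccontr)
    assume "T (t, c) \<noteq> v"
    then have val: "T (t, c) \<in> {1..v - 1}" using entry_pos[OF T t(2)] t by auto
    then have "T (T (t, c), c) = T (t, c)"
      using full_column[OF T _ _ full] t vn by (auto simp: cell_iff)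
    moreover have "(T (t, c), c) \<in> skyline \<beta>"
      using val full t vn by (auto simp: cell_iff)
    ultimately show False
      using column_inj[OF T _ t(2)] val t s by fastforce
  qed
qed

lemma low_row_determined:
  assumes T: "T \<in> qKT \<beta>" and U: "U \<in> qKT \<beta>"
    and v: "1 \<le> v" "v \<le> n" "\<forall>k\<in>{1..v}. len v \<le> len k"
    and agree: "\<And>b. b \<in> skyline \<beta> \<Longrightarrow> T b \<le> v \<longleftrightarrow> U b \<le> v"
    and card: "card {b \<in> skyline \<beta>. T b = v} = card {b \<in> skyline \<beta>. U b = v}"
    and b: "b \<in> skyline \<beta>"
  shows "T b = v \<longleftrightarrow> U b = v"
proof -
  \<comment> \<open>only in the lowest row \<open>s\<close> with an entry at most \<open>v\<close> above row \<open>v\<close> are the entries \<open>v\<close> undetermined\<close>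
  define S where "S = {i. v < i \<and> (\<exists>c. (i, c) \<in> skyline \<beta> \<and> T (i, c) \<le> v)}"
  define s where "s = (LEAST i. i \<in> S)"
  have S_U: "S = {i. v < i \<and> (\<exists>c. (i, c) \<in> skyline \<beta> \<and> U (i, c) \<le> v)}"
    using agree by (auto simp: S_def)
  have other: "T (i, c) = v \<longleftrightarrow> U (i, c) = v" if "i \<noteq> s" and cell: "(i, c) \<in> skyline \<beta>" for i c
  proof -
    consider "i < v" | "i = v" | "v < i" "T (i, c) \<le> v" | "v < i" "\<not> T (i, c) \<le> v" by linarith
    then show ?thesis
    proof cases
      case 1
      then show ?thesis using entry_le[OF T cell] entry_le[OF U cell] by auto
    next
      case 2
      have "\<forall>k\<in>{1..v}. c \<le> len k" using cell v 2 by (auto simp: cell_iff)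
      then show ?thesis
        using full_column[OF T v(2)] full_column[OF U v(2)] cell v 2 by (auto simp: cell_iff)
    next
      case 3
      then have "i \<in> S" using cell by (auto simp: S_def)
      then have "s \<in> S" "s \<le> i" unfolding s_def by (auto intro: LeastI Least_le)
      then have "s < i" using that by simp
      moreover have "U (i, c) \<le> v" using agree cell 3 by blast
      moreover obtain c1 where "v < s" "(s, c1) \<in> skyline \<beta>" "T (s, c1) \<le> v"
        using \<open>s \<in> S\<close> by (auto simp: S_def)
      moreover obtain c2 where "(s, c2) \<in> skyline \<beta>" "U (s, c2) \<le> v"
        using \<open>s \<in> S\<close> by (auto simp: S_U)
      ultimately show ?thesis
        using second_row_value[OF T v(1,3)] second_row_value[OF U v(1,3)] cell 3 by metis
    next
      case 4
      then show ?thesis using agree[OF cell] by auto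
    qed
  qed
  define X where "X T = {c. (s, c) \<in> skyline \<beta> \<and> T (s, c) = v}" for T :: filling
  have split_count: "card {b \<in> skyline \<beta>. T b = v} =
      card {b \<in> skyline \<beta>. fst b \<noteq> s \<and> T b = v} + card (X T)" for T :: filling
  proof -
    have "{b \<in> skyline \<beta>. T b = v} = {b \<in> skyline \<beta>. fst b \<noteq> s \<and> T b = v} \<union> Pair s ` X T"
      by (auto simp: X_def)
    moreover have "finite (Pair s ` X T)"
      by (rule finite_subset[OF _ finite_skyline[of \<beta>]]) (auto simp: X_def)
    moreover have "card (Pair s ` X T) = card (X T)" by (intro card_image) (auto simp: inj_on_def)
    ultimately show ?thesis
      using finite_skyline[of \<beta>] by (subst \<open>_ = _ \<union> _\<close>, subst card_Un_disjoint) auto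
  qed
  have "{b \<in> skyline \<beta>. fst b \<noteq> s \<and> T b = v} = {b \<in> skyline \<beta>. fst b \<noteq> s \<and> U b = v}"
    by (intro Collect_cong) (metis other prod.collapse)
  then have cardX: "card (X T) = card (X U)" using split_count[of T] split_count[of U] card by simp
  have finX: "finite (X T)" for T
    by (rule finite_subset[of _ "{..len s}"]) (auto simp: X_def cell_iff)
  \<comment> \<open>if nonempty, both start at the first entry at most \<open>v\<close> of row \<open>s\<close>, which \<open>T\<close> and \<open>U\<close> have in the same column\<close>
  have "X T \<subseteq> X U \<or> X U \<subseteq> X T"
  proof (rule ccontr)
    assume "\<not> ?thesis"
    then obtain c d where cd: "c \<in> X T" "c \<notin> X U" "d \<in> X U" "d \<notin> X T" by blast
    then have cells: "(s, c) \<in> skyline \<beta>" "(s, d) \<in> skyline \<beta>" and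
      eqs: "T (s, c) = v" "U (s, d) = v" "U (s, c) \<noteq> v" "T (s, d) \<noteq> v"
      by (auto simp: X_def)
    then have "U (s, c) < v" "T (s, d) < v"
      using agree[OF cells(1)] agree[OF cells(2)] by auto
    then show False
      using row_decreasing[OF T, of c d s] row_decreasing[OF T, of d c s]
        row_decreasing[OF U, of c d s] row_decreasing[OF U, of d c s] cells eqs by linarith
  qed
  then have "X T = X U" using cardX finX by (metis card_subset_eq)
  moreover obtain i c where ic: "b = (i, c)" by (cases b)
  ultimately show ?thesis
    using other[of i c] b by (cases "i = s") (auto simp: X_def)
qed

lemma value_determined:
  assumes T: "T \<in> qKT \<beta>" and U: "U \<in> qKT \<beta>" and v: "1 \<le> v" "v \<le> n"
    and agree: "\<And>b. b \<in> skyline \<beta> \<Longrightarrow> T b \<le> v \<longleftrightarrow> U b \<le> v"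
    and card: "card {b \<in> skyline \<beta>. T b = v} = card {b \<in> skyline \<beta>. U b = v}"
    and b: "b \<in> skyline \<beta>"
  shows "T b = v \<longleftrightarrow> U b = v"
proof (cases "\<forall>k\<in>{1..v}. len v \<le> len k")
  case True
  then show ?thesis using low_row_determined[OF T U v True agree card b] by blast
next
  case False
  then obtain k where "k \<in> {1..<v}" "len k < len v"
    by (metis atLeastAtMost_iff atLeastLessThan_iff le_neq_implies_less less_irrefl not_le)
  then show ?thesis using high_row_determined[OF T U _ _ v(2) agree card b] by blast
qed

theorem weight_inj: "inj_on (weight \<beta>) (qKT \<beta>)"
proof (rule inj_onI)
  fix T U assume T: "T \<in> qKT \<beta>" and U: "U \<in> qKT \<beta>" and w: "weight \<beta> T = weight \<beta> U"
  have card: "card {b \<in> skyline \<beta>. T b = v} = card {b \<in> skyline \<beta>. U b = v}" for v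
    using arg_cong[OF w, of "\<lambda>p. Poly_Mapping.lookup p v"] by (simp add: weight.rep_eq)
  have above: "b \<in> skyline \<beta> \<Longrightarrow> n - m < T b \<or> n - m < U b \<Longrightarrow> T b = U b" for m b
  proof (induction m arbitrary: b)
    case 0
    then show ?case using entry_le[OF T] entry_le[OF U] by (cases b) (fastforce simp: cell_iff)
  next
    case (Suc m)
    show ?case
    proof (cases "m < n")
      case True
      define v where "v = n - m"
      have v: "1 \<le> v" "v \<le> n" "n - Suc m = v - 1" using True by (auto simp: v_def)
      have "T b = v \<longleftrightarrow> U b = v" if "b \<in> skyline \<beta>" for b
        by (rule value_determined[OF T U v(1,2) _ card that])
          (metis Suc.IH v_def not_le)
      moreover have "v < T b \<or> v < U b \<Longrightarrow> T b = U b"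
        using Suc by (simp add: v_def)
      ultimately show ?thesis using Suc.prems v by (metis One_nat_def Suc_pred' less_Suc_eq less_eq_Suc_le not_less_eq)
    qed (use Suc in simp)
  qed
  have "T b = U b" if "b \<in> skyline \<beta>" for b
    using above[of b n] entry_pos[OF T that] that by simp
  moreover have "T \<in> extensional (skyline \<beta>)" "U \<in> extensional (skyline \<beta>)"
    using T U by (auto simp: qKT_def PiE_def)
  ultimately show "T = U" by (intro extensionalityI)
qed

end


section \<open>Multiplicity-freeness\<close>

lemma multiplicity_free_if_weight_inj:
  assumes "inj_on (weight \<beta>) (qKT \<beta>)"
  shows "multiplicity_free (quasi_key \<beta>)"
  unfolding multiplicity_free_def
proof
  fix m
  have "Poly_Mapping.lookup (quasi_key \<beta>) m = (\<Sum>T\<in>qKT \<beta>. if weight \<beta> T = m then 1 else 0)"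
    by (auto simp: quasi_key_def lookup_sum lookup_single when_def intro!: sum.cong)
  also have "\<dots> = (\<Sum>w\<in>weight \<beta> ` qKT \<beta>. if w = m then 1 else 0)"
    using assms by (simp add: sum.reindex)
  also have "\<dots> \<in> {0, 1}" by (simp add: sum.delta finite_qKT)
  finally show "Poly_Mapping.lookup (quasi_key \<beta>) m \<in> {0, 1}" .
qed


lemma no_double_ascent_cong:
  assumes "\<And>x. x < N \<Longrightarrow> a x = b x"
  shows "no_double_ascent N a \<longleftrightarrow> no_double_ascent N b"
  unfolding no_double_ascent_def
proof (intro all_cong1 imp_cong refl)
  fix k j i assume "k < N" "j < k" "i < j"
  then have "a k = b k" "a j = b j" "a i = b i" by (simp_all add: assms)
  then show "(a i < a j) = (b i < b j)" "(a k \<le> a j) = (b k \<le> b j)" by simp_all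
qed

lemma tight_ascent_pairs_cong:
  assumes "\<And>x. x < N \<Longrightarrow> a x = b x"
  shows "tight_ascent_pairs N a \<longleftrightarrow> tight_ascent_pairs N b"
  unfolding tight_ascent_pairs_def
proof (intro all_cong1 imp_cong refl)
  fix s r q p assume "s < N" "r < s" "q < r" "p < q"
  then have "a s = b s" "a r = b r" "a q = b q" "a p = b p" by (simp_all add: assms)
  then show "(a p < a r \<and> a p < a s \<and> a q < a r \<and> a q < a s) =
      (b p < b r \<and> b p < b s \<and> b q < b r \<and> b q < b s)"
    "(a p = a q \<and> a r = Suc (a q) \<and> a s = Suc (a q)) =
      (b p = b q \<and> b r = Suc (b q) \<and> b s = Suc (b q))"
    by simp_all
qed

lemma tame_shape_left_swap:
  assumes "left_swap \<alpha> \<beta>" "tame_shape \<alpha>"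
  shows "tame_shape \<beta>"
  using assms(1)
proof cases
  case (1 i j)
  interpret tame_shape \<alpha> by (rule assms(2))
  let ?a = "((!) \<alpha>)(i := \<alpha> ! j, j := \<alpha> ! i)"
  have nth: "\<beta> ! x = ?a x" if "x < length \<alpha>" for x
    using that 1 by (simp add: nth_list_update)
  have len: "length \<beta> = length \<alpha>" using 1 by simp
  show ?thesis
  proof
    show "1 \<le> \<beta> ! x" if "x < length \<beta>" for x
      using that parts_pos 1 by (simp add: nth_list_update)
    show "no_double_ascent (length \<beta>) ((!) \<beta>)"
      using no_double_ascent_swap[OF double pairs 1(2-4)] no_double_ascent_cong[of _ "(!) \<beta>" ?a, OF nth] len by simp
    show "tight_ascent_pairs (length \<beta>) ((!) \<beta>)"
      using tight_ascent_pairs_swap[OF pairs 1(2-4)] tight_ascent_pairs_cong[of _ "(!) \<beta>" ?a, OF nth] len by simp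
  qed
qed

lemma tame_shape_lswap:
  assumes "tame_shape \<alpha>" "\<beta> \<in> lswap \<alpha>"
  shows "tame_shape \<beta>"
proof -
  have "left_swap\<^sup>*\<^sup>* \<alpha> \<beta>" using assms(2) by (simp add: lswap_def)
  then show ?thesis using assms(1) by (induction rule: rtranclp_induct) (auto intro: tame_shape_left_swap)
qed

lemma tame_shape_KM_bar_ge1:
  assumes "\<alpha> \<in> KM_bar_ge1 n"
  shows "tame_shape \<alpha>"
proof
  show "1 \<le> \<alpha> ! i" if "i < length \<alpha>" for i
    using that assms by (auto simp: KM_bar_ge1_def Comp_def)
qed (fact KM_bar_ge1_no_double_ascent[OF assms] KM_bar_ge1_tight_ascent_pairs[OF assms])+

theorem theorem2p6:
  fixes n :: nat and \<alpha> \<beta> :: comp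
  assumes "\<alpha> \<in> KM_bar_ge1 n"
    and "\<beta> \<in> Qlswap \<alpha>"
  shows "multiplicity_free (quasi_key \<beta>)"
proof (rule multiplicity_free_if_weight_inj)
  have "\<beta> \<in> lswap \<alpha>" using assms(2) by (simp add: Qlswap_def)
  then interpret tame_shape \<beta>
    using tame_shape_KM_bar_ge1[OF assms(1)] by (rule tame_shape_lswap[rotated])
  show "inj_on (weight \<beta>) (qKT \<beta>)" by (rule weight_inj)
qed

end
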